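(* In the quantum switch entanglement-buffer model described in the context, fix edge weights $\{w_e\}_{e\in E}$ and operate the switch under the randomized decomposition policy with these fixed weights. For an edge $e=(u,v)\in E$, let $\mathbb P(L_u>0,L_v>0)$ be the stationary probability that the buffers at both endpoints of $e$ are nonempty, and let $C_u,C_v$ be the steady-state availabilities of the reference chains $\tilde L_u,\tilde L_v$. Then $$\mathbb P(L_u>0,\,L_v>0)\ \ge\ (C_u+C_v-1)^+ .$$
   Context: **Model.** $G=(V,E)$ is a finite graph; $\delta(v)$ is the set of edges incident to $v$; $E(S)$ is the set of edges with both endpoints in $S$; $\mathcal M$ is the set of matchings of $G$, with indicator vectors $\mathbf 1_M\in\{0,1\}^E$; $x^+=\max(x,0)$. Each node $v$ has a finite buffer size $B_v\ge1$ and parameters $\lambda_v,\mu_v\in(0,1)$, and stores $L_v(t)\in\{0,\dots,B_v\}$ entanglements at slot $t=0,1,2,\dots$. In each slot, in this order: 1. A matching $M(t)$ is chosen. 2. Each edge $e=(u,v)\in M(t)$ with $L_u(t)>0$ and $L_v(t)>0$ is served, which removes one entanglement from $u$ and one from $v$ (request-queue emptiness is ignored). 3. Each remaining entanglement at node $v$ is lost independently with probability $\mu_v$. 4. One new entanglement arrives at $v$ with probability $\lambda_v$, and the buffer content is truncated at $B_v$. All randomness is independent across nodes and slots and independent of the scheduling randomness. **Randomized decomposition policy with fixed weights $\{w_e\}$.** Let $\mathbf x^*$ be an optimal solution of the LP: maximize $\sum_ew_ex_e$ subject to $\sum_{e\in\delta(v)}x_e\le\lambda_v$ for all $v\in V$;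 $\sum_{e\in E(S)}x_e\le\frac{|S|-1}2$ for all $S\subseteq V$ with $|S|$ odd and $|S|\ge3$; and $x_e\ge0$ for all $e$. Then $\mathbf x^*$ lies in the convex hull of the $\mathbf 1_M$. Fix probabilities $(p_M)_{M\in\mathcal M}$ with $p_M\ge0$, $\sum_Mp_M=1$ and $\sum_Mp_M\mathbf 1_M=\mathbf x^*$. In every slot, independently, $M(t)=M$ with probability $p_M$. Under this policy $\mathbf L(t)=(L_v(t))_{v\in V}$ is a finite Markov chain, and "stationary" refers to its stationary distribution. **Reference chain and availability.** For node $u$, the reference chain $\tilde L_u(t)$ on $\{0,\dots,B_u\}$ evolves as follows. From state $i$, draw independent $S\sim\mathrm{Bernoulli}(p_u)$ with $p_u=\lambda_u$ and $A\sim\mathrm{Bernoulli}(\lambda_u)$, draw $K\sim\mathrm{Binom}(\max(0,i-S),1-\mu_u)$ (independent of $A$ given $S$), and move to $\min(B_u,K+A)$. With $\pi$ its stationary distribution, $C_u=1-\pi_0$. *)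

theory Defs
  imports "HOL-Probability.Probability"
begin

definition finite_graph :: "'v set \<Rightarrow> 'v set set \<Rightarrow> bool" where
  "finite_graph V E \<longleftrightarrow> finite V \<and> E \<subseteq> {e. e \<subseteq> V \<and> card e = 2}"

definition incident_edges :: "'v set set \<Rightarrow> 'v \<Rightarrow> 'v set set" where
  "incident_edges E v = {e \<in> E. v \<in> e}"

definition induced_edges :: "'v set set \<Rightarrow> 'v set \<Rightarrow> 'v set set" where
  "induced_edges E S = {e \<in> E. e \<subseteq> S}"

definition matchings :: "'v set set \<Rightarrow> 'v set set set" where
  "matchings E = {M. M \<subseteq> E \<and> pairwise disjnt M}"

definition lp_feasible ::
    "'v set \<Rightarrow> 'v set set \<Rightarrow> ('v \<Rightarrow> real) \<Rightarrow> ('v set \<Rightarrow> real) \<Rightarrow> bool" where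
  "lp_feasible V E lam x \<longleftrightarrow>
     (\<forall>v\<in>V. (\<Sum>e\<in>incident_edges E v. x e) \<le> lam v) \<and>
     (\<forall>S. S \<subseteq> V \<and> odd (card S) \<and> card S \<ge> 3 \<longrightarrow>
        (\<Sum>e\<in>induced_edges E S. x e) \<le> (real (card S) - 1) / 2) \<and>
     (\<forall>e\<in>E. x e \<ge> 0)"

definition lp_optimal ::
    "'v set \<Rightarrow> 'v set set \<Rightarrow> ('v \<Rightarrow> real) \<Rightarrow> ('v set \<Rightarrow> real) \<Rightarrow> ('v set \<Rightarrow> real) \<Rightarrow> bool" where
  "lp_optimal V E lam w x \<longleftrightarrow>
     lp_feasible V E lam x \<and>
     (\<forall>y. lp_feasible V E lam y \<longrightarrow> (\<Sum>e\<in>E. w e * y e) \<le> (\<Sum>e\<in>E. w e * x e))"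

definition matching_decomposition ::
    "'v set set \<Rightarrow> ('v set \<Rightarrow> real) \<Rightarrow> 'v set set pmf \<Rightarrow> bool" where
  "matching_decomposition E x p \<longleftrightarrow>
     set_pmf p \<subseteq> matchings E \<and>
     (\<forall>e\<in>E. (\<Sum>M\<in>matchings E. pmf p M * of_bool (e \<in> M)) = x e)"

definition served :: "('v \<Rightarrow> nat) \<Rightarrow> 'v set set \<Rightarrow> 'v set set" where
  "served L M = {e \<in> M. \<forall>v\<in>e. L v > 0}"

(* number of survivors among n entanglements, each lost independently with probability m *)
definition survivors_pmf :: "nat \<Rightarrow> real \<Rightarrow> nat pmf" where
  "survivors_pmf n m =
     map_pmf (\<lambda>lost. card {j. j < n \<and> \<not> lost j}) (Pi_pmf {..<n} False (\<lambda>_. bernoulli_pmf m))"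

(* n is the content of the buffer after service, b its size *)
definition node_update :: "nat \<Rightarrow> real \<Rightarrow> real \<Rightarrow> nat \<Rightarrow> nat pmf" where
  "node_update b l m n = do {
     K \<leftarrow> survivors_pmf n m;
     A \<leftarrow> bernoulli_pmf l;
     return_pmf (min b (K + of_bool A))
   }"

(* A matching contains at most one edge at v, so the cardinality below is 0 or 1.
   Pi_pmf makes the nodes of V independent and assigns 0 to everything outside V. *)
definition switch_step ::
    "'v set \<Rightarrow> ('v \<Rightarrow> nat) \<Rightarrow> ('v \<Rightarrow> real) \<Rightarrow> ('v \<Rightarrow> real) \<Rightarrow> 'v set set pmf
       \<Rightarrow> ('v \<Rightarrow> nat) \<Rightarrow> ('v \<Rightarrow> nat) pmf" where
  "switch_step V B lam mu p L = do {
     M \<leftarrow> p;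
     Pi_pmf V 0 (\<lambda>v. node_update (B v) (lam v) (mu v) (L v - card {e \<in> served L M. v \<in> e}))
   }"

definition switch_states :: "'v set \<Rightarrow> ('v \<Rightarrow> nat) \<Rightarrow> ('v \<Rightarrow> nat) set" where
  "switch_states V B = {L. (\<forall>v\<in>V. L v \<le> B v) \<and> (\<forall>v. v \<notin> V \<longrightarrow> L v = 0)}"

(* s is the parameter of the Bernoulli service variable *)
definition reference_step :: "nat \<Rightarrow> real \<Rightarrow> real \<Rightarrow> real \<Rightarrow> nat \<Rightarrow> nat pmf" where
  "reference_step b s l m i = do {
     S \<leftarrow> bernoulli_pmf s;
     A \<leftarrow> bernoulli_pmf l;
     K \<leftarrow> binomial_pmf (i - of_bool S) (1 - m);
     return_pmf (min b (K + of_bool A))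
   }"

definition stationary_distribution :: "'s set \<Rightarrow> ('s \<Rightarrow> 's pmf) \<Rightarrow> 's pmf \<Rightarrow> bool" where
  "stationary_distribution X step q \<longleftrightarrow> set_pmf q \<subseteq> X \<and> bind_pmf q step = q"

definition availability :: "nat pmf \<Rightarrow> real" where
  "availability q = 1 - pmf q 0"

end

theory Submission
  imports Defs
begin

text \<open>
  Everything reduces to the marginal bound that the stationary probability of \<open>L\<^sub>u > 0\<close> is at
  least \<open>C\<^sub>u\<close>; the two marginal bounds combine by \<open>P(A \<inter> B) \<ge> P(A) + P(B) - 1\<close>.

  The marginal bound is a stochastic comparison. Given the state and the matching, service removes
  at most one entanglement from \<open>u\<close>, and none if the matching misses \<open>u\<close>. The matching covers \<open>u\<close>
  with probability at most \<open>\<Sum>e\<in>\<delta>(u). x\<^sub>e \<le> \<lambda>\<^sub>u\<close>, independently of the state, so \<open>u\<close> is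
  served at most as often as in the reference chain, where this probability is \<open>\<lambda>\<^sub>u\<close>. If \<open>R\<close> is the
  reference kernel and \<open>q\<close> the stationary law of the switch, this says that
  \<open>E\<^sub>q f(L\<^sub>u) \<ge> E\<^sub>q (R f)(L\<^sub>u)\<close> for every nondecreasing \<open>f\<close>
  (\<open>switch_expectation_ge_reference\<close>).

  Let \<open>b\<close> be the buffer size of \<open>u\<close>. The kernel \<open>R\<close> preserves monotonicity, and from
  every state it reaches 0 in one step with a probability bounded below. Hence the span \<open>f(b) - f(0)\<close> of a nondecreasing function shrinks by a
  fixed factor under \<open>R\<close>. Since the stationary law \<open>r\<close> of the reference chain satisfies
  \<open>E\<^sub>r f = E\<^sub>r (R f)\<close>, iteration shows \<open>E\<^sub>r f - E\<^sub>q f(L\<^sub>u) \<le> c\<^sup>n (f(b) - f(0))\<close> for every \<open>n\<close> with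
  some \<open>c < 1\<close>, so that \<open>E\<^sub>r f \<le> E\<^sub>q f(L\<^sub>u)\<close> (\<open>expectation_le_if_subinvariant\<close>). The indicator
  of the positive numbers gives the marginal bound. No uniqueness of stationary distributions is
  needed. Test functions are taken with values in \<open>[0,1]\<close>, which makes all expectations finite.
\<close>

section \<open>Expectations of functions with values in the unit interval\<close>

declare image_subset_iff [simp]

lemma integrable_unit_interval:
  fixes f :: "'a \<Rightarrow> real"
  assumes "range f \<subseteq> {0..1}"
  shows "integrable (measure_pmf p) f"
  by (rule measure_pmf.integrable_const_bound[where B = 1]) (use assms in auto)

lemma integrable_indicator_pmf [simp]:
  "integrable (measure_pmf p) (indicator A :: 'a \<Rightarrow> real)"
  by (rule integrable_unit_interval) (auto simp: indicator_def)

lemma expectation_affine_indicator: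
  fixes c d :: real
  shows "integrable (measure_pmf p) (\<lambda>x. c - d * indicator A x)" (is ?thesis1)
    and "measure_pmf.expectation p (\<lambda>x. c - d * indicator A x) = c - d * measure_pmf.prob p A"
      (is ?thesis2)
proof -
  have int: "integrable (measure_pmf p) (\<lambda>x. d * indicator A x)"
    by (intro integrable_mult_right integrable_indicator_pmf)
  then show ?thesis1
    by (intro Bochner_Integration.integrable_diff) simp_all
  show ?thesis2
    by (subst Bochner_Integration.integral_diff) (simp_all add: int)
qed

lemma expectation_unit_interval:
  fixes f :: "'a \<Rightarrow> real"
  assumes "range f \<subseteq> {0..1}"
  shows "measure_pmf.expectation p f \<in> {0..1}"
proof -
  have "measure_pmf.expectation p f \<le> measure_pmf.expectation p (\<lambda>_. 1)"
    using assms by (intro integral_mono integrable_unit_interval) auto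
  moreover have "measure_pmf.expectation p f \<ge> 0"
    using assms by (intro integral_nonneg_AE) auto
  ultimately show ?thesis by simp
qed

lemma expectation_mono_unit_interval:
  fixes f g :: "'a \<Rightarrow> real"
  assumes "range f \<subseteq> {0..1}" "range g \<subseteq> {0..1}" "\<And>x. x \<in> set_pmf p \<Longrightarrow> f x \<le> g x"
  shows "measure_pmf.expectation p f \<le> measure_pmf.expectation p g"
  using assms by (intro integral_mono_AE integrable_unit_interval) (auto simp: AE_measure_pmf_iff)

lemma nn_integral_eq_expectation:
  fixes f :: "'a \<Rightarrow> real"
  assumes "range f \<subseteq> {0..1}"
  shows "(\<integral>\<^sup>+x. ennreal (f x) \<partial>measure_pmf p) = ennreal (measure_pmf.expectation p f)"
  using assms by (intro nn_integral_eq_integral integrable_unit_interval) auto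

lemma expectation_bind_unit_interval:
  fixes f :: "'b \<Rightarrow> real"
  assumes f: "range f \<subseteq> {0..1}"
  shows "measure_pmf.expectation (bind_pmf p k) f
           = measure_pmf.expectation p (\<lambda>x. measure_pmf.expectation (k x) f)"
proof -
  let ?g = "\<lambda>x. measure_pmf.expectation (k x) f"
  have g: "range ?g \<subseteq> {0..1}"
    using expectation_unit_interval[OF f] by auto
  have "ennreal (measure_pmf.expectation (bind_pmf p k) f)
          = (\<integral>\<^sup>+y. ennreal (f y) \<partial>measure_pmf (bind_pmf p k))"
    by (rule nn_integral_eq_expectation[OF f, symmetric])
  also have "\<dots> = (\<integral>\<^sup>+x. (\<integral>\<^sup>+y. ennreal (f y) \<partial>measure_pmf (k x)) \<partial>measure_pmf p)"
    by (rule nn_integral_bind_pmf)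
  also have "\<dots> = (\<integral>\<^sup>+x. ennreal (?g x) \<partial>measure_pmf p)"
    by (simp only: nn_integral_eq_expectation[OF f])
  also have "\<dots> = ennreal (measure_pmf.expectation p ?g)"
    by (rule nn_integral_eq_expectation[OF g])
  finally have "ennreal (measure_pmf.expectation (bind_pmf p k) f)
                  = ennreal (measure_pmf.expectation p ?g)" .
  then show ?thesis
    using expectation_unit_interval[OF f, of "bind_pmf p k"] expectation_unit_interval[OF g, of p]
    by simp
qed

section \<open>Comparison of stationary laws\<close>

text \<open>
  The law of the observable \<open>Y\<close> under \<open>q\<close> does not have to be invariant under the kernel \<open>R\<close>: it
  suffices that one step of \<open>R\<close> from that law does not increase the expectation of any
  nondecreasing function. The hypothesis \<open>reach\<close> makes \<open>R\<close> contract the span of such functions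
  by the factor \<open>1 - R(b, 0)\<close>; for a monotone kernel it is enough to assume it at the top state.
\<close>

lemma expectation_le_if_subinvariant:
  fixes R :: "nat \<Rightarrow> nat pmf" and Y :: "'s \<Rightarrow> nat" and f :: "nat \<Rightarrow> real"
  assumes mono_R: "\<And>f :: nat \<Rightarrow> real. mono f \<Longrightarrow> range f \<subseteq> {0..1} \<Longrightarrow>
                     mono (\<lambda>i. measure_pmf.expectation (R i) f)"
    and range_R: "set_pmf (R b) \<subseteq> {0..b}"
    and reach: "0 \<in> set_pmf (R b)"
    and subinvariant: "\<And>f :: nat \<Rightarrow> real. mono f \<Longrightarrow> range f \<subseteq> {0..1} \<Longrightarrow>
          measure_pmf.expectation q (\<lambda>s. measure_pmf.expectation (R (Y s)) f)
            \<le> measure_pmf.expectation q (\<lambda>s. f (Y s))"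
    and r: "stationary_distribution {0..b} R r"
    and f: "mono f" "range f \<subseteq> {0..1}"
  shows "measure_pmf.expectation r f \<le> measure_pmf.expectation q (\<lambda>s. f (Y s))"
proof -
  define c where "c = 1 - pmf (R b) 0"
  have c: "0 \<le> c" "c < 1"
    using reach by (auto simp: c_def pmf_le_1 pmf_positive)
  have contraction: "measure_pmf.expectation (R b) g - measure_pmf.expectation (R 0) g
                       \<le> c * (g b - g 0)"
    if g: "mono g" "range g \<subseteq> {0..1}" for g :: "nat \<Rightarrow> real"
  proof -
    have "g 0 = measure_pmf.expectation (R 0) (\<lambda>_. g 0)" by simp
    also have "\<dots> \<le> measure_pmf.expectation (R 0) g"
      using g(2) by (intro expectation_mono_unit_interval) (auto intro!: monoD[OF g(1)])
    finally have lower: "g 0 \<le> measure_pmf.expectation (R 0) g" .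
    \<comment> \<open>From the top state, the mass at 0 contributes \<open>g 0\<close> and the rest at most \<open>g b\<close>.\<close>
    have "measure_pmf.expectation (R b) g
            \<le> measure_pmf.expectation (R b) (\<lambda>i. g b - (g b - g 0) * indicator {0} i)"
    proof (rule integral_mono_AE)
      show "AE i in measure_pmf (R b). g i \<le> g b - (g b - g 0) * indicator {0} i"
        using range_R by (auto simp: AE_measure_pmf_iff indicator_def intro!: monoD[OF g(1)])
    qed (use g in \<open>simp_all add: integrable_unit_interval expectation_affine_indicator(1)\<close>)
    also have "\<dots> = g b - (g b - g 0) * pmf (R b) 0"
      by (simp add: expectation_affine_indicator(2) measure_pmf_single)
    finally show ?thesis
      using lower by (simp add: c_def algebra_simps)
  qed
  have gap: "measure_pmf.expectation r g - measure_pmf.expectation q (\<lambda>s. g (Y s))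
               \<le> c ^ n * (g b - g 0)"
    if "mono g" "range g \<subseteq> {0..1}" for g :: "nat \<Rightarrow> real" and n
    using that
  proof (induction n arbitrary: g)
    case (0 g)
    have "measure_pmf.expectation r g \<le> measure_pmf.expectation r (\<lambda>_. g b)"
      using 0(2) r
      by (intro expectation_mono_unit_interval)
         (auto simp: stationary_distribution_def intro!: monoD[OF 0(1)])
    moreover have "measure_pmf.expectation q (\<lambda>_. g 0) \<le> measure_pmf.expectation q (\<lambda>s. g (Y s))"
      using 0(2) by (intro expectation_mono_unit_interval) (auto intro!: monoD[OF 0(1)])
    ultimately show ?case by simp
  next
    case (Suc n g)
    let ?Rg = "\<lambda>i. measure_pmf.expectation (R i) g"
    have Rg: "mono ?Rg" "range ?Rg \<subseteq> {0..1}"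
      using mono_R[OF Suc.prems] expectation_unit_interval[OF Suc.prems(2)] by auto
    have "measure_pmf.expectation r g = measure_pmf.expectation (bind_pmf r R) g"
      using r by (simp add: stationary_distribution_def)
    also have "\<dots> = measure_pmf.expectation r ?Rg"
      by (rule expectation_bind_unit_interval[OF Suc.prems(2)])
    finally have "measure_pmf.expectation r g - measure_pmf.expectation q (\<lambda>s. g (Y s))
        \<le> measure_pmf.expectation r ?Rg - measure_pmf.expectation q (\<lambda>s. ?Rg (Y s))"
      using subinvariant[OF Suc.prems] by linarith
    also have "\<dots> \<le> c ^ n * (?Rg b - ?Rg 0)"
      by (rule Suc.IH[OF Rg])
    also have "\<dots> \<le> c ^ n * (c * (g b - g 0))"
      using contraction[OF Suc.prems] c by (intro mult_left_mono) auto
    finally show ?case by (simp add: mult_ac)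
  qed
  have "(\<lambda>n. c ^ n * (f b - f 0)) \<longlonglongrightarrow> 0"
    using c by (intro tendsto_mult_left_zero LIMSEQ_realpow_zero) auto
  then have "measure_pmf.expectation r f - measure_pmf.expectation q (\<lambda>s. f (Y s)) \<le> 0"
    by (rule LIMSEQ_le_const) (use gap[OF f] in blast)
  then show ?thesis by simp
qed

section \<open>The reference chain\<close>

text \<open>
  The switch keeps one loss indicator for each entanglement, the reference chain draws a binomial
  number of survivors; negating the indicators identifies the two laws.
\<close>

lemma survivors_pmf_eq_binomial:
  assumes "0 \<le> m" "m \<le> 1"
  shows "survivors_pmf n m = binomial_pmf n (1 - m)"
proof -
  have bern: "bernoulli_pmf (1 - m) = map_pmf Not (bernoulli_pmf m)"
  proof (rule pmf_eqI)
    fix y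
    have "pmf (map_pmf Not (bernoulli_pmf m)) (\<not> \<not> y) = pmf (bernoulli_pmf m) (\<not> y)"
      by (rule pmf_map_inj') (auto simp: inj_def)
    then show "pmf (bernoulli_pmf (1 - m)) y = pmf (map_pmf Not (bernoulli_pmf m)) y"
      using assms by (cases y) simp_all
  qed
  have "binomial_pmf n (1 - m)
          = map_pmf (\<lambda>f. card {x\<in>{..<n}. f x}) (Pi_pmf {..<n} True (\<lambda>_. bernoulli_pmf (1 - m)))"
    using assms by (intro binomial_pmf_altdef') auto
  also have "Pi_pmf {..<n} True (\<lambda>_. bernoulli_pmf (1 - m))
      = map_pmf (\<lambda>h. Not \<circ> h) (Pi_pmf {..<n} False (\<lambda>_. bernoulli_pmf m))"
    unfolding bern by (rule Pi_pmf_map) auto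
  finally show ?thesis
    by (simp add: survivors_pmf_def map_pmf_comp)
qed

lemma reference_step_eq_node_update:
  assumes "0 \<le> m" "m \<le> 1"
  shows "reference_step b s l m i
           = bind_pmf (bernoulli_pmf s) (\<lambda>S. node_update b l m (i - of_bool S))"
  unfolding reference_step_def node_update_def survivors_pmf_eq_binomial[OF assms]
  by (intro bind_pmf_cong refl bind_commute_pmf)

lemma mono_expectation_binomial:
  fixes f :: "nat \<Rightarrow> real"
  assumes "0 \<le> a" "a \<le> 1" and f: "mono f" "range f \<subseteq> {0..1}"
  shows "mono (\<lambda>n. measure_pmf.expectation (binomial_pmf n a) f)"
proof (rule mono_iff_le_Suc[THEN iffD2], rule allI)
  fix n
  let ?E = "\<lambda>h. measure_pmf.expectation (binomial_pmf n a) h"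
  \<comment> \<open>The additional trial raises the count by 1 with probability \<open>a\<close> and leaves it unchanged otherwise.\<close>
  have shift: "?E f \<le> ?E (\<lambda>k. f (Suc k))"
    using f(2) by (intro expectation_mono_unit_interval) (auto intro!: monoD[OF f(1)])
  have "?E f = a * ?E f + (1 - a) * ?E f"
    by (simp add: algebra_simps)
  also have "\<dots> \<le> a * ?E (\<lambda>k. f (Suc k)) + (1 - a) * ?E f"
    using shift assms by (intro add_mono mult_left_mono) auto
  also have "\<dots> = measure_pmf.expectation (binomial_pmf (Suc n) a) f"
    using assms
    by (simp add: binomial_pmf_Suc expectation_bind_unit_interval[OF f(2)] mult_ac)
  finally show "?E f \<le> measure_pmf.expectation (binomial_pmf (Suc n) a) f" .
qed

lemma mono_expectation_node_update:
  fixes f :: "nat \<Rightarrow> real"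
  assumes "0 \<le> l" "l \<le> 1" "0 \<le> m" "m \<le> 1" and f: "mono f" "range f \<subseteq> {0..1}"
  shows "mono (\<lambda>n. measure_pmf.expectation (node_update b l m n) f)"
proof -
  \<comment> \<open>Averaging over the arrival and truncating turns \<open>f\<close> into a monotone function of the survivors.\<close>
  let ?h = "\<lambda>k. f (min b (Suc k)) * l + f (min b k) * (1 - l)"
  have conv: "?h k \<in> {0..1}" for k
  proof -
    have "f j \<in> {0..1}" for j using f(2) by auto
    then have "f (min b (Suc k)) * l + f (min b k) * (1 - l) \<le> 1 * l + 1 * (1 - l)"
      using assms(1,2) by (intro add_mono mult_right_mono) auto
    moreover have "0 \<le> ?h k"
      using assms(1,2) \<open>\<And>j. f j \<in> {0..1}\<close> by auto
    ultimately show ?thesis by simp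
  qed
  have "mono ?h"
    using assms(1,2) f(1) by (intro monoI add_mono mult_right_mono) (auto intro!: monoD[OF f(1)])
  moreover have "measure_pmf.expectation (node_update b l m n) f
      = measure_pmf.expectation (binomial_pmf n (1 - m)) ?h" for n
    using assms
    by (simp add: node_update_def survivors_pmf_eq_binomial expectation_bind_unit_interval[OF f(2)])
  ultimately show ?thesis
    using mono_expectation_binomial[of "1 - m" ?h] assms(3,4) conv by auto
qed

lemma expectation_reference_step:
  fixes f :: "nat \<Rightarrow> real"
  assumes "0 \<le> s" "s \<le> 1" "0 \<le> m" "m \<le> 1" and f: "range f \<subseteq> {0..1}"
  shows "measure_pmf.expectation (reference_step b s l m i) f
           = s * measure_pmf.expectation (node_update b l m (i - 1)) f
             + (1 - s) * measure_pmf.expectation (node_update b l m i) f"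
  using assms
  by (simp add: reference_step_eq_node_update expectation_bind_unit_interval[OF f] mult_ac)

lemma mono_expectation_reference_step:
  fixes f :: "nat \<Rightarrow> real"
  assumes s: "0 \<le> s" "s \<le> 1" and lm: "0 \<le> l" "l \<le> 1" "0 \<le> m" "m \<le> 1"
    and f: "mono f" "range f \<subseteq> {0..1}"
  shows "mono (\<lambda>i. measure_pmf.expectation (reference_step b s l m i) f)"
  unfolding expectation_reference_step[OF s lm(3,4) f(2)]
  using s
  by (intro monoI add_mono mult_left_mono monoD[OF mono_expectation_node_update[OF lm f]]) auto

lemma set_pmf_reference_step_le: "set_pmf (reference_step b s l m i) \<subseteq> {0..b}"
  by (auto simp: reference_step_def)

lemma zero_in_set_pmf_reference_step:
  assumes "0 \<le> s" "s \<le> 1" "0 \<le> l" "l < 1" "0 < m" "m < 1"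
  shows "0 \<in> set_pmf (reference_step b s l m i)"
proof -
  have "False \<in> set_pmf (bernoulli_pmf l)"
    using assms by (simp add: set_pmf_iff)
  moreover have "0 \<in> set_pmf (binomial_pmf j (1 - m))" for j
    using assms by simp
  moreover obtain S where "S \<in> set_pmf (bernoulli_pmf s)"
    using set_pmf_not_empty[of "bernoulli_pmf s"] by blast
  moreover have "0 \<in> set_pmf (return_pmf (min b (0 + of_bool False)))" by simp
  ultimately show ?thesis
    unfolding reference_step_def set_bind_pmf by blast
qed

section \<open>One node of the switch\<close>

lemma finite_matchings: "finite E \<Longrightarrow> finite (matchings E)"
  by (rule finite_subset[of _ "Pow E"]) (auto simp: matchings_def)

lemma card_served_le:
  assumes "M \<in> matchings E" "finite E"
  shows "card {e \<in> served L M. a \<in> e} \<le> of_bool (\<exists>e\<in>M. a \<in> e)"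
proof (cases "\<exists>e\<in>M. a \<in> e")
  case True
  have "{e \<in> served L M. a \<in> e} \<subseteq> M"
    by (auto simp: served_def)
  moreover have "M \<subseteq> E" using assms(1) by (simp add: matchings_def)
  ultimately have fin: "finite {e \<in> served L M. a \<in> e}"
    using assms(2) by (meson finite_subset)
  have "e = e'" if "e \<in> served L M" "a \<in> e" "e' \<in> served L M" "a \<in> e'" for e e'
    using that assms(1) unfolding served_def matchings_def pairwise_def disjnt_def by blast
  with fin have "card {e \<in> served L M. a \<in> e} \<le> Suc 0"
    by (subst card_le_Suc0_iff_eq) auto
  with True show ?thesis by simp
next
  case False
  then have "{e \<in> served L M. a \<in> e} = {}" by (auto simp: served_def)
  then show ?thesis by (simp only: card.empty)
qed

text \<open>A union bound: the edges at \<open>a\<close> are selected with the marginal probabilities \<open>x\<close>.\<close>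

lemma prob_covered_le:
  assumes "finite E" "matching_decomposition E x p"
  shows "measure_pmf.prob p {M. \<exists>e\<in>M. a \<in> e} \<le> (\<Sum>e\<in>incident_edges E a. x e)"
proof -
  have fin: "finite (incident_edges E a)"
    using assms(1) by (simp add: incident_edges_def)
  have supp: "set_pmf p \<subseteq> matchings E"
    using assms(2) by (simp add: matching_decomposition_def)
  have edge: "measure_pmf.prob p {M. e \<in> M} = x e" if "e \<in> E" for e
  proof -
    have "measure_pmf.prob p {M. e \<in> M} = measure_pmf.expectation p (indicator {M. e \<in> M})"
      by simp
    also have "\<dots> = (\<Sum>M\<in>matchings E. pmf p M * of_bool (e \<in> M))"
      using finite_matchings[OF assms(1)] supp
      by (subst integral_measure_pmf_real[of "matchings E"])
         (auto simp: indicator_def mult_ac intro!: sum.cong)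
    finally show ?thesis
      using assms(2) that by (simp add: matching_decomposition_def)
  qed
  have "measure_pmf.prob p {M. \<exists>e\<in>M. a \<in> e}
          = measure_pmf.prob p ({M. \<exists>e\<in>M. a \<in> e} \<inter> set_pmf p)"
    by (simp add: measure_Int_set_pmf)
  also have "\<dots> \<le> measure_pmf.prob p (\<Union>e\<in>incident_edges E a. {M. e \<in> M})"
    using supp
    by (intro measure_pmf.finite_measure_mono) (fastforce simp: incident_edges_def matchings_def)+
  also have "\<dots> \<le> (\<Sum>e\<in>incident_edges E a. measure_pmf.prob p {M. e \<in> M})"
    using fin by (intro measure_pmf.finite_measure_subadditive_finite) auto
  also have "\<dots> = (\<Sum>e\<in>incident_edges E a. x e)"
    by (intro sum.cong) (auto simp: edge incident_edges_def)
  finally show ?thesis .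
qed

text \<open>
  Started from any state, the buffer at \<open>a\<close> after one slot of the switch dominates stochastically
  the reference chain after one step, as long as the service probability of the latter is at least
  the probability that the matching covers \<open>a\<close>.
\<close>

lemma switch_step_expectation_ge_reference:
  fixes f :: "nat \<Rightarrow> real"
  assumes "finite V" "finite E" "a \<in> V"
    and lm: "0 \<le> lam a" "lam a \<le> 1" "0 \<le> mu a" "mu a \<le> 1"
    and supp: "set_pmf p \<subseteq> matchings E"
    and s: "measure_pmf.prob p {M. \<exists>e\<in>M. a \<in> e} \<le> s" "s \<le> 1"
    and f: "mono f" "range f \<subseteq> {0..1}"
  shows "measure_pmf.expectation (reference_step (B a) s (lam a) (mu a) (L a)) f
           \<le> measure_pmf.expectation (switch_step V B lam mu p L) (\<lambda>L'. f (L' a))"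
proof -
  define g where "g n = measure_pmf.expectation (node_update (B a) (lam a) (mu a) n) f" for n
  define D where "D M = card {e \<in> served L M. a \<in> e}" for M
  let ?covered = "{M. \<exists>e\<in>M. a \<in> e}"
  have g: "mono g" "range g \<subseteq> {0..1}"
    using mono_expectation_node_update[OF lm f] expectation_unit_interval[OF f(2)]
    unfolding g_def by auto
  have s0: "0 \<le> s"
    using s(1) measure_nonneg[of "measure_pmf p" ?covered] by linarith
  \<comment> \<open>The intermediate case is the one where every matching covering \<open>a\<close> serves it.\<close>
  have "measure_pmf.expectation (reference_step (B a) s (lam a) (mu a) (L a)) f
          = g (L a) - s * (g (L a) - g (L a - 1))"
    using expectation_reference_step[OF s0 s(2) lm(3,4) f(2)] by (simp add: g_def algebra_simps)
  also have "\<dots> \<le> g (L a) - measure_pmf.prob p ?covered * (g (L a) - g (L a - 1))"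
    using s(1) monoD[OF g(1), of "L a - 1" "L a"] by (intro diff_left_mono mult_right_mono) auto
  also have "\<dots> = measure_pmf.expectation p
                    (\<lambda>M. g (L a) - (g (L a) - g (L a - 1)) * indicator ?covered M)"
    by (simp only: expectation_affine_indicator(2) mult.commute[of "measure_pmf.prob p ?covered"])
  also have "\<dots> \<le> measure_pmf.expectation p (\<lambda>M. g (L a - D M))"
  proof (rule integral_mono_AE)
    have "g (L a) - (g (L a) - g (L a - 1)) * indicator ?covered M \<le> g (L a - D M)"
      if "M \<in> matchings E" for M
      using card_served_le[OF that assms(2), of L a]
      by (cases "\<exists>e\<in>M. a \<in> e") (auto simp: D_def indicator_def intro!: monoD[OF g(1)])
    then show "AE M in measure_pmf p.
        g (L a) - (g (L a) - g (L a - 1)) * indicator ?covered M \<le> g (L a - D M)"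
      using supp by (auto simp: AE_measure_pmf_iff)
  qed (use g in \<open>simp_all add: integrable_unit_interval expectation_affine_indicator(1)\<close>)
  also have "\<dots> = measure_pmf.expectation (switch_step V B lam mu p L) (\<lambda>L'. f (L' a))"
  proof -
    have marginal: "measure_pmf.expectation (Pi_pmf V 0 N) (\<lambda>L'. f (L' a))
                      = measure_pmf.expectation (N a) f" for N
    proof -
      have "measure_pmf.expectation (Pi_pmf V 0 N) (\<lambda>L'. f (L' a))
              = measure_pmf.expectation (map_pmf (\<lambda>L'. L' a) (Pi_pmf V 0 N)) f"
        by simp
      then show ?thesis
        using assms(1,3) by (simp only: Pi_pmf_component if_True)
    qed
    have "range (\<lambda>L'. f (L' a)) \<subseteq> {0..1}" using f(2) by auto
    then show ?thesis
      by (simp add: switch_step_def expectation_bind_unit_interval marginal g_def D_def)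
  qed
  finally show ?thesis .
qed

lemma switch_expectation_ge_reference:
  fixes f :: "nat \<Rightarrow> real"
  assumes "finite V" "finite E" "a \<in> V"
    and lm: "0 \<le> lam a" "lam a \<le> 1" "0 \<le> mu a" "mu a \<le> 1"
    and supp: "set_pmf p \<subseteq> matchings E"
    and s: "measure_pmf.prob p {M. \<exists>e\<in>M. a \<in> e} \<le> s" "s \<le> 1"
    and q: "bind_pmf q (switch_step V B lam mu p) = q"
    and f: "mono f" "range f \<subseteq> {0..1}"
  shows "measure_pmf.expectation q
             (\<lambda>L. measure_pmf.expectation (reference_step (B a) s (lam a) (mu a) (L a)) f)
           \<le> measure_pmf.expectation q (\<lambda>L. f (L a))"
proof -
  have fa: "range (\<lambda>L. f (L a)) \<subseteq> {0..1}" using f(2) by auto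
  have "measure_pmf.expectation q
             (\<lambda>L. measure_pmf.expectation (reference_step (B a) s (lam a) (mu a) (L a)) f)
          \<le> measure_pmf.expectation q
             (\<lambda>L. measure_pmf.expectation (switch_step V B lam mu p L) (\<lambda>L'. f (L' a)))"
  proof (rule expectation_mono_unit_interval)
    show "measure_pmf.expectation (reference_step (B a) s (lam a) (mu a) (L a)) f
            \<le> measure_pmf.expectation (switch_step V B lam mu p L) (\<lambda>L'. f (L' a))" for L
      by (rule switch_step_expectation_ge_reference) (fact assms)+
  qed (use expectation_unit_interval[OF f(2)] expectation_unit_interval[OF fa] in auto)
  also have "\<dots> = measure_pmf.expectation (bind_pmf q (switch_step V B lam mu p)) (\<lambda>L. f (L a))"
    by (rule expectation_bind_unit_interval[OF fa, symmetric])
  finally show ?thesis by (simp add: q)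
qed

lemma prob_nonempty_ge_availability:
  assumes graph: "finite_graph V E" and a: "a \<in> V"
    and lam: "0 < lam a" "lam a < 1" and mu: "0 < mu a" "mu a < 1"
    and feasible: "lp_feasible V E lam x"
    and decomposition: "matching_decomposition E x p"
    and q: "bind_pmf q (switch_step V B lam mu p) = q"
    and r: "stationary_distribution {0..B a} (reference_step (B a) (lam a) (lam a) (mu a)) r"
  shows "availability r \<le> measure_pmf.prob q {L. L a > 0}"
proof -
  have fin: "finite V" "finite E"
    using graph finite_subset[of E "Pow V"] by (auto simp: finite_graph_def)
  have supp: "set_pmf p \<subseteq> matchings E"
    using decomposition by (simp add: matching_decomposition_def)
  have covered: "measure_pmf.prob p {M. \<exists>e\<in>M. a \<in> e} \<le> lam a"
    using prob_covered_le[OF fin(2) decomposition, of a] feasible a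
    by (force simp: lp_feasible_def)
  let ?f = "indicator {0<..} :: nat \<Rightarrow> real"
  have f: "mono ?f" "range ?f \<subseteq> {0..1}"
    by (auto simp: mono_def indicator_def)
  have "availability r = measure_pmf.prob r (UNIV - {0})"
    using measure_pmf.prob_compl[of "{0}" r] by (simp add: availability_def measure_pmf_single)
  also have "UNIV - {0} = {0::nat<..}" by auto
  also have "measure_pmf.prob r {0<..} = measure_pmf.expectation r ?f" by simp
  also have "\<dots> \<le> measure_pmf.expectation q (\<lambda>L. ?f (L a))"
    using lam mu a fin supp covered q r f
    by (intro expectation_le_if_subinvariant[where b = "B a"
            and R = "reference_step (B a) (lam a) (lam a) (mu a)"]
          mono_expectation_reference_step set_pmf_reference_step_le
          zero_in_set_pmf_reference_step switch_expectation_ge_reference) auto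
  also have "(\<lambda>L. ?f (L a)) = indicator {L. L a > 0}"
    by (auto simp: indicator_def)
  also have "measure_pmf.expectation q \<dots> = measure_pmf.prob q {L. L a > 0}" by simp
  finally show ?thesis .
qed

section \<open>The availability bound for an edge\<close>

theorem lemma1:
  fixes V :: "'v set" and E :: "'v set set"
    and B :: "'v \<Rightarrow> nat" and lam mu :: "'v \<Rightarrow> real"
    and w x :: "'v set \<Rightarrow> real" and p :: "'v set set pmf"
    and q :: "('v \<Rightarrow> nat) pmf" and r\<^sub>u r\<^sub>v :: "nat pmf" and u v :: 'v
  assumes graph: "finite_graph V E"
    and buffers: "\<And>a. a \<in> V \<Longrightarrow> B a \<ge> 1"
    and arrivals: "\<And>a. a \<in> V \<Longrightarrow> 0 < lam a \<and> lam a < 1"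
    and losses: "\<And>a. a \<in> V \<Longrightarrow> 0 < mu a \<and> mu a < 1"
    and optimal: "lp_optimal V E lam w x"
    and decomposition: "matching_decomposition E x p"
    and stationary: "stationary_distribution (switch_states V B) (switch_step V B lam mu p) q"
    and edge: "{u, v} \<in> E"
    and reference_u:
      "stationary_distribution {0..B u} (reference_step (B u) (lam u) (lam u) (mu u)) r\<^sub>u"
    and reference_v:
      "stationary_distribution {0..B v} (reference_step (B v) (lam v) (lam v) (mu v)) r\<^sub>v"
  shows "measure_pmf.prob q {L. L u > 0 \<and> L v > 0}
           \<ge> max (availability r\<^sub>u + availability r\<^sub>v - 1) 0"
proof -
  let ?P = "measure_pmf.prob q"
  have nodes: "u \<in> V" "v \<in> V"
    using graph edge by (auto simp: finite_graph_def)
  have feasible: "lp_feasible V E lam x"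
    using optimal by (simp add: lp_optimal_def)
  have q: "bind_pmf q (switch_step V B lam mu p) = q"
    using stationary by (simp add: stationary_distribution_def)
  have u: "availability r\<^sub>u \<le> ?P {L. L u > 0}"
    using nodes arrivals losses reference_u
    by (intro prob_nonempty_ge_availability[OF graph _ _ _ _ _ feasible decomposition q]) auto
  have v: "availability r\<^sub>v \<le> ?P {L. L v > 0}"
    using nodes arrivals losses reference_v
    by (intro prob_nonempty_ge_availability[OF graph _ _ _ _ _ feasible decomposition q]) auto
  have "?P ({L. L u > 0} \<union> {L. L v > 0})
          = ?P {L. L u > 0} + ?P {L. L v > 0} - ?P ({L. L u > 0} \<inter> {L. L v > 0})"
    by (rule measure_Un3) (auto simp: measure_pmf.fmeasurable_eq_sets)
  moreover have "?P ({L. L u > 0} \<union> {L. L v > 0}) \<le> 1"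
    by (rule measure_pmf.prob_le_1)
  ultimately have "?P {L. L u > 0} + ?P {L. L v > 0} - 1 \<le> ?P ({L. L u > 0} \<inter> {L. L v > 0})"
    by linarith
  also have "{L. L u > 0} \<inter> {L. L v > 0} = {L. L u > 0 \<and> L v > 0}" by auto
  finally have "?P {L. L u > 0} + ?P {L. L v > 0} - 1 \<le> ?P {L. L u > 0 \<and> L v > 0}" .
  with u v show ?thesis by simp
qed

end
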